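(* Let $(\mathfrak t,T)$ be an admissible dataset, with $\mathfrak t=(t_1,\dots,t_n)$, $t_1<\dots<t_n$, and $T=(T_1,\dots,T_n)\in\mathbb R^n$. Then the best approximation to $(\mathfrak t,T)$ is an exponential (that is, there exist $a,b,k\in\mathbb R$ with $ak\neq 0$ such that $\max_{i}|a\exp(kt_i)+b-T_i|\le \max_i|a'\exp(k't_i)+b'-T_i|$ for all $a',b',k'\in\mathbb R$ with $a'k'\ne 0$) if and only if the following condition $(\spadesuit)$ does not hold: $(\spadesuit)$ $T_1=\max\{T_1,\dots,T_n\}$ and the second greatest value of $T$, namely $M_T=\max\{T_2,\dots,T_n\}$, is attained after the minimum of $T$, i.e. there are indices $j<l$ with $l\geq 2$, $T_j=\min\{T_1,\dots,T_n\}$ and $T_l=M_T$.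
   Context: A dataset is a pair $(\mathfrak t,T)$ with $\mathfrak t,T\in\mathbb R^n$ and $t_1<t_2<\dots<t_n$. Errors are measured in the max-norm $\|v\|_\infty=\max_i|v_i|$. An exponential is a function $f(t)=a\exp(kt)+b$ with $a,b,k\in\mathbb R$, $ak\neq 0$. For a function $r:\mathbb R\to\mathbb R$, write $\mathfrak r(\mathfrak t)=(r(t_1),\dots,r(t_n))$. Let $r(t)=at+b$ be the line that best approximates $(\mathfrak t,T)$, i.e. the one minimizing $\|T-\mathfrak r(\mathfrak t)\|_\infty$ among all lines. The dataset $(\mathfrak t,T)$ is admissible when the slope satisfies $a<0$ and there exist $1\le i<j<m\le n$ such that: 1. $T_i-r(t_i)=r(t_j)-T_j=T_m-r(t_m)=\|T-\mathfrak r(\mathfrak t)\|_\infty$; 2. $-\|T-\mathfrak r(\mathfrak t)\|_\infty\le r(t_l)-T_l<\|T-\mathfrak r(\mathfrak t)\|_\infty$ for every $l<i$ and every $l>m$; 3. $-\|T-\mathfrak r(\mathfrak t)\|_\infty\le T_l-r(t_l)<\|T-\mathfrak r(\mathfrak t)\|_\infty$ for every $i<l<m$. *)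

theory Defs
  imports Complex_Main
begin

text \<open>
  Vectors of \<open>\<real>\<^sup>n\<close> are functions \<open>nat \<Rightarrow> real\<close> of which only the values on the
  indices \<open>{1..n}\<close> matter.
\<close>

definition dataset :: "nat \<Rightarrow> (nat \<Rightarrow> real) \<Rightarrow> bool" where
  "dataset n t \<longleftrightarrow> strict_mono_on {1..n} t"

definition max_norm :: "nat \<Rightarrow> (nat \<Rightarrow> real) \<Rightarrow> real" where
  "max_norm n v = Max ((\<lambda>i. \<bar>v i\<bar>) ` {1..n})"

definition best_line :: "nat \<Rightarrow> (nat \<Rightarrow> real) \<Rightarrow> (nat \<Rightarrow> real) \<Rightarrow> real \<Rightarrow> real \<Rightarrow> bool" where
  "best_line n t T a b \<longleftrightarrow>
     (\<forall>a' b'. max_norm n (\<lambda>i. T i - (a * t i + b)) \<le> max_norm n (\<lambda>i. T i - (a' * t i + b')))"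

text \<open>
  The indices \<open>i < j < m\<close> below force \<open>n \<ge> 3\<close>, so the best line of an admissible dataset is
  unique and quantifying it existentially is harmless.
\<close>

definition admissible :: "nat \<Rightarrow> (nat \<Rightarrow> real) \<Rightarrow> (nat \<Rightarrow> real) \<Rightarrow> bool" where
  "admissible n t T \<longleftrightarrow> dataset n t \<and>
     (\<exists>a b. best_line n t T a b \<and> a < 0 \<and>
       (let r = (\<lambda>x. a * x + b); E = max_norm n (\<lambda>l. T l - r (t l)) in
         \<exists>i j m. 1 \<le> i \<and> i < j \<and> j < m \<and> m \<le> n \<and>
           T i - r (t i) = E \<and> r (t j) - T j = E \<and> T m - r (t m) = E \<and>
           (\<forall>l\<in>{1..n}. l < i \<or> m < l \<longrightarrow> - E \<le> r (t l) - T l \<and> r (t l) - T l < E) \<and>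
           (\<forall>l\<in>{1..n}. i < l \<and> l < m \<longrightarrow> - E \<le> T l - r (t l) \<and> T l - r (t l) < E)))"

definition spade :: "nat \<Rightarrow> (nat \<Rightarrow> real) \<Rightarrow> bool" where
  "spade n T \<longleftrightarrow> T 1 = Max (T ` {1..n}) \<and>
     (\<exists>j\<in>{1..n}. \<exists>l\<in>{2..n}. j < l \<and> T j = Min (T ` {1..n}) \<and> T l = Max (T ` {2..n}))"

end

theory Submission
  imports Defs "HOL-Analysis.Analysis"
begin

text \<open>
  Let \<open>r\<close> be the best line, \<open>E\<close> its error, and let \<open>M\<close> and \<open>\<mu>\<close> be the greatest and the least of
  \<open>T 2, \<dots>, T n\<close>. Exponentials are not a closed family: on the data points their limits are the
  exponentials themselves, the lines (rate \<open>k \<rightarrow> 0\<close>), and the step functions that are constant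
  except at the first or at the last point (\<open>k \<rightarrow> -\<infinity>\<close>, \<open>k \<rightarrow> \<infinity>\<close>). A best exponential exists as
  soon as some exponential is strictly better than all the limits of the last two kinds.

  Only the limits for \<open>k \<rightarrow> 0\<close> and \<open>k \<rightarrow> -\<infinity>\<close> matter. A function with error below \<open>E\<close> runs
  above \<open>r\<close> at \<open>t i\<close>, below it at \<open>t j\<close> and above it at \<open>t m\<close>; so an exponential of this quality
  is convex and decreasing, with \<open>k < 0\<close> (\<open>decreasing_if_below_E\<close>). As \<open>k \<rightarrow> 0\<close> the error comes up to
  at least \<open>E\<close>. As \<open>k \<rightarrow> -\<infinity>\<close> the values at all points after the first merge into one number, and
  no number is closer than \<open>(M - \<mu>) / 2\<close> to both \<open>M\<close> and \<open>\<mu>\<close>. Hence one exponential with error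
  below both \<open>E\<close> and \<open>(M - \<mu>) / 2\<close> confines the search to a compact set of parameters
  (\<open>best_exponential_exists\<close>).

  Such an exponential is found by perturbing the limit that it must beat. An exponential of small
  rate that crosses \<open>r\<close> just after \<open>t i\<close> and again just before \<open>t m\<close> corrects \<open>r\<close> in the right
  direction wherever the residual is \<open>\<plusminus>E\<close>, so its error is below \<open>E\<close>
  (\<open>exponential_beats_line\<close>). If \<open>(M - \<mu>) / 2 < E\<close>, it turns out that \<open>i = 1\<close> and that \<open>T 1\<close> is
  the maximum, so that the failure of \<open>spade\<close> means that every occurrence of \<open>M\<close> after the first
  point comes before every occurrence of \<open>\<mu>\<close>. A steep decreasing exponential that takes the value
  \<open>(M + \<mu>) / 2\<close> between the two kinds of occurrences then has error below \<open>(M - \<mu>) / 2\<close>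
  (\<open>exponential_beats_steps\<close>).

  Conversely, under \<open>spade\<close> the step function with values \<open>T 1\<close> and \<open>(M + \<mu>) / 2\<close> has error
  \<open>(M - \<mu>) / 2\<close> and is a limit of exponentials, but no exponential is as good: it would have to be
  at least \<open>(M + \<mu>) / 2\<close> at the first point, at most this at an occurrence of \<open>\<mu>\<close>, and at least this
  at a later occurrence of \<open>M\<close>, against strict monotonicity (\<open>no_best_exponential_if_spade\<close>).
\<close>

section \<open>The max-norm\<close>

lemma max_norm_le_iff:
  assumes "1 \<le> n"
  shows "max_norm n v \<le> e \<longleftrightarrow> (\<forall>i\<in>{1..n}. \<bar>v i\<bar> \<le> e)"
  unfolding max_norm_def using assms by (subst Max_le_iff) auto

lemma max_norm_less_iff:
  assumes "1 \<le> n"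
  shows "max_norm n v < e \<longleftrightarrow> (\<forall>i\<in>{1..n}. \<bar>v i\<bar> < e)"
  unfolding max_norm_def using assms by (subst Max_less_iff) auto

lemma continuous_on_Max_image:
  fixes f :: "'i \<Rightarrow> 'a::topological_space \<Rightarrow> real"
  assumes "finite I" "I \<noteq> {}" "\<And>i. i \<in> I \<Longrightarrow> continuous_on S (f i)"
  shows "continuous_on S (\<lambda>x. Max ((\<lambda>i. f i x) ` I))"
  using assms
proof (induction I rule: finite_ne_induct)
  case (insert i I)
  then show ?case
    by (simp add: continuous_on_max)
qed simp

text \<open>
  The principle behind both improvements: a correction \<open>w\<close> that tends to \<open>0\<close> strictly lowers the
  error \<open>\<delta>\<close> once it has the sign of the residual \<open>d\<close> at the extremal points. Elsewhere it is enough
  that the correction is small.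
\<close>

lemma eventually_perturbed_residual_less:
  fixes d :: "'i \<Rightarrow> real" and w :: "'k \<Rightarrow> 'i \<Rightarrow> real"
  assumes "finite I" and "0 < \<delta>"
    and d: "\<And>l. l \<in> I \<Longrightarrow> \<bar>d l\<bar> \<le> \<delta>"
    and w: "\<And>l. l \<in> I \<Longrightarrow> ((\<lambda>k. w k l) \<longlongrightarrow> 0) F"
    and pos: "\<And>l. l \<in> I \<Longrightarrow> d l = \<delta> \<Longrightarrow> \<forall>\<^sub>F k in F. 0 < w k l"
    and neg: "\<And>l. l \<in> I \<Longrightarrow> d l = - \<delta> \<Longrightarrow> \<forall>\<^sub>F k in F. w k l < 0"
  shows "\<forall>\<^sub>F k in F. \<forall>l\<in>I. \<bar>d l - w k l\<bar> < \<delta>"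
proof (rule eventually_ball_finite[OF \<open>finite I\<close>], intro ballI)
  fix l assume l: "l \<in> I"
  have small: "\<forall>\<^sub>F k in F. \<bar>w k l\<bar> < e" if "0 < e" for e
    using tendstoD[OF w[OF l] that] by simp
  consider "d l = \<delta>" | "d l = - \<delta>" | "\<bar>d l\<bar> < \<delta>"
    using d[OF l] by linarith
  then show "\<forall>\<^sub>F k in F. \<bar>d l - w k l\<bar> < \<delta>"
  proof cases
    case 1
    show ?thesis
      using pos[OF l 1] small[OF \<open>0 < \<delta>\<close>] by eventually_elim (use 1 in linarith)
  next
    case 2
    show ?thesis
      using neg[OF l 2] small[OF \<open>0 < \<delta>\<close>] by eventually_elim (use 2 in linarith)
  next
    case 3
    then have gap: "0 < \<delta> - \<bar>d l\<bar>" by simp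
    show ?thesis
      using small[OF gap] by eventually_elim linarith
  qed
qed

section \<open>Exponentials through two points\<close>

text \<open>
  Strict convexity of \<open>x \<mapsto> exp (k * x)\<close>, with denominators cleared so that it can be multiplied
  by a factor of either sign: the graph lies strictly above its tangent at \<open>y\<close>.
\<close>

lemma exp_scaled_strictly_convex:
  fixes k x y z :: real
  assumes "k \<noteq> 0" "x < y" "y < z"
  shows "(z - x) * exp (k * y) < (z - y) * exp (k * x) + (y - x) * exp (k * z)"
proof -
  have tangent: "exp (k * y) * (1 + k * (s - y)) < exp (k * s)" if "s \<noteq> y" for s
  proof -
    have "1 - k * (y - s) < exp (- (k * (y - s)))"
      by (subst exp_minus_greater) (use that assms(1) in simp)
    then have "1 + k * (s - y) < exp (k * (s - y))" by (simp add: algebra_simps)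
    then have "exp (k * y) * (1 + k * (s - y)) < exp (k * y) * exp (k * (s - y))" by simp
    then show ?thesis by (simp add: algebra_simps flip: exp_add)
  qed
  have "(z - y) * (exp (k * y) * (1 + k * (x - y))) < (z - y) * exp (k * x)"
    using tangent[of x] assms by (intro mult_strict_left_mono) auto
  moreover have "(y - x) * (exp (k * y) * (1 + k * (z - y))) < (y - x) * exp (k * z)"
    using tangent[of z] assms by (intro mult_strict_left_mono) auto
  ultimately show ?thesis by (simp add: algebra_simps)
qed

text \<open>
  The exponential of rate \<open>k\<close> normalised to be \<open>0\<close> at \<open>u\<close> and \<open>1\<close> at \<open>w\<close>. Unlike the coefficients
  \<open>a\<close>, \<open>b\<close>, which may blow up as the rate tends to \<open>0\<close> or \<open>-\<infinity>\<close>, the coefficients of the form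
  \<open>p + q * exp_chord k u w x\<close> are governed by the values at \<open>u\<close> and \<open>w\<close>.
\<close>

definition exp_chord :: "real \<Rightarrow> real \<Rightarrow> real \<Rightarrow> real \<Rightarrow> real" where
  "exp_chord k u w x = (exp (k * (x - u)) - 1) / (exp (k * (w - u)) - 1)"

lemma exponential_eq_exp_chord:
  assumes "k \<noteq> 0" "u < w"
  shows "a * exp (k * x) + b
    = (a * exp (k * u) + b) + (a * exp (k * w) - a * exp (k * u)) * exp_chord k u w x"
proof -
  have "exp (k * (w - u)) - 1 \<noteq> 0" using assms by simp
  moreover have "exp (k * y) = exp (k * u) * exp (k * (y - u))" for y
    by (simp add: algebra_simps flip: exp_add)
  then have "exp (k * x) = exp (k * u) * exp (k * (x - u))"
    "exp (k * w) = exp (k * u) * exp (k * (w - u))" by blast+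
  ultimately show ?thesis
    unfolding exp_chord_def by (simp only:) (simp add: divide_simps, simp add: algebra_simps)
qed

lemma exp_chord_is_exponential:
  assumes "k \<noteq> 0" "q \<noteq> 0" "u < w"
  obtains a b where "a * k \<noteq> 0" "\<And>x. p + q * exp_chord k u w x = a * exp (k * x) + b"
proof
  define D where "D = exp (k * (w - u)) - 1"
  have "D \<noteq> 0" using assms by (simp add: D_def)
  then show "q * exp (- k * u) / D * k \<noteq> 0" using assms by simp
  show "p + q * exp_chord k u w x = q * exp (- k * u) / D * exp (k * x) + (p - q / D)" for x
  proof -
    have "exp (k * (x - u)) = exp (- k * u) * exp (k * x)"
      by (simp add: algebra_simps flip: exp_add)
    then have "exp_chord k u w x = (exp (- k * u) * exp (k * x) - 1) / D"
      unfolding exp_chord_def D_def by (simp only:)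
    then show ?thesis
      using \<open>D \<noteq> 0\<close> by (simp only:) (simp add: field_simps)
  qed
qed

text \<open>
  Numerator and denominator, divided by \<open>k\<close>, are difference quotients at \<open>0\<close>.
\<close>

lemma exp_chord_tendsto_line:
  assumes "u < w"
  shows "((\<lambda>k. exp_chord k u w x) \<longlongrightarrow> (x - u) / (w - u)) (at 0)"
proof -
  have diff: "((\<lambda>k. (exp (k * c) - 1) / k) \<longlongrightarrow> c) (at 0)" for c :: real
  proof -
    have "((\<lambda>k. exp (k * c)) has_real_derivative c) (at 0)"
      by (auto intro!: derivative_eq_intros)
    then show ?thesis by (simp add: has_field_derivative_iff)
  qed
  have "((\<lambda>k. ((exp (k * (x - u)) - 1) / k) / ((exp (k * (w - u)) - 1) / k))
      \<longlongrightarrow> (x - u) / (w - u)) (at 0)"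
    using assms by (intro tendsto_divide diff) auto
  moreover have "\<forall>\<^sub>F k in at 0. ((exp (k * (x - u)) - 1) / k) / ((exp (k * (w - u)) - 1) / k)
      = exp_chord k u w x"
    using eventually_neq_at_within[of 0 0 UNIV]
    by eventually_elim (simp add: exp_chord_def)
  ultimately show ?thesis by (rule Lim_transform_eventually)
qed

lemma exp_tendsto_0_at_bot:
  assumes "0 < c"
  shows "((\<lambda>k::real. exp (k * c)) \<longlongrightarrow> 0) at_bot"
proof -
  have "filterlim (\<lambda>k. c * k) at_bot at_bot"
    using assms by (intro filterlim_tendsto_pos_mult_at_bot[OF tendsto_const] filterlim_ident)
  then show ?thesis
    by (intro filterlim_compose[OF exp_at_bot]) (simp add: mult.commute)
qed

lemma exp_chord_tendsto_1_at_bot: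
  assumes "u < w" "u < x"
  shows "((\<lambda>k. exp_chord k u w x) \<longlongrightarrow> 1) at_bot"
proof -
  have "((\<lambda>k. exp_chord k u w x) \<longlongrightarrow> (0 - 1) / (0 - 1)) at_bot"
    unfolding exp_chord_def using assms
    by (intro tendsto_divide tendsto_diff exp_tendsto_0_at_bot tendsto_const) auto
  then show ?thesis by simp
qed

text \<open>
  For \<open>k < 0\<close> the denominator of \<open>exp_chord\<close> is negative, which turns the convexity of the exponential
  into concavity.
\<close>

lemma exp_chord_vs_line:
  assumes "k < 0" "u < w"
  shows "u < x \<Longrightarrow> x < w \<Longrightarrow> (x - u) / (w - u) < exp_chord k u w x"
    and "x < u \<or> w < x \<Longrightarrow> exp_chord k u w x < (x - u) / (w - u)"
proof -
  have D: "exp (k * (w - u)) - 1 < 0" using assms by (simp add: mult_neg_pos)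
  have convex: "(z - x) * exp (k * y) < (z - y) * exp (k * x) + (y - x) * exp (k * z)"
    if "x < y" "y < z" for x y z
    using exp_scaled_strictly_convex that assms(1) by auto
  show "(x - u) / (w - u) < exp_chord k u w x" if "u < x" "x < w"
    using convex[of 0 "x - u" "w - u"] that D assms
    by (simp add: exp_chord_def divide_simps) (simp add: algebra_simps)
  show "exp_chord k u w x < (x - u) / (w - u)" if "x < u \<or> w < x"
    using convex[of "x - u" 0 "w - u"] convex[of 0 "w - u" "x - u"] that D assms
    by (auto simp add: exp_chord_def divide_simps) (simp_all add: algebra_simps)
qed


section \<open>Data whose best line is too low at the ends\<close>

text \<open>
  The data of an admissible dataset with the witnesses named. The residual of the best line is \<open>E\<close>,
  \<open>-E\<close>, \<open>E\<close> at \<open>i < j < m\<close>; it reaches \<open>-E\<close> only strictly between \<open>i\<close> and \<open>m\<close>, and \<open>E\<close> never there.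
\<close>

locale convex_residual =
  fixes n :: nat and t T :: "nat \<Rightarrow> real" and \<alpha> \<beta> E :: real and i j m :: nat
  assumes strict_t: "strict_mono_on {1..n} t"
    and best: "best_line n t T \<alpha> \<beta>"
    and slope: "\<alpha> < 0"
    and E_eq: "E = max_norm n (\<lambda>l. T l - (\<alpha> * t l + \<beta>))"
    and order: "1 \<le> i" "i < j" "j < m" "m \<le> n"
    and at_i: "T i - (\<alpha> * t i + \<beta>) = E"
    and at_j: "(\<alpha> * t j + \<beta>) - T j = E"
    and at_m: "T m - (\<alpha> * t m + \<beta>) = E"
    and outer: "\<And>l. l \<in> {1..n} \<Longrightarrow> l < i \<or> m < l \<Longrightarrow> (\<alpha> * t l + \<beta>) - T l < E"
    and inner: "\<And>l. i < l \<Longrightarrow> l < m \<Longrightarrow> T l - (\<alpha> * t l + \<beta>) < E"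
begin

abbreviation (input) r :: "real \<Rightarrow> real" where
  "r x \<equiv> \<alpha> * x + \<beta>"

abbreviation (input) err :: "real \<Rightarrow> real \<Rightarrow> real \<Rightarrow> real" where
  "err a b k \<equiv> max_norm n (\<lambda>l. a * exp (k * t l) + b - T l)"

definition M :: real where "M = Max (T ` {2..n})"

definition \<mu> :: real where "\<mu> = Min (T ` {2..n})"

lemma n_ge: "3 \<le> n" "1 \<le> n"
  using order by auto

lemma t_less: "1 \<le> p \<Longrightarrow> p < q \<Longrightarrow> q \<le> n \<Longrightarrow> t p < t q"
  using strict_t by (auto simp: strict_mono_on_def)

lemma t_ij: "t i < t j" and t_jm: "t j < t m"
  using t_less order by auto

lemma r_decreasing: "x < y \<Longrightarrow> r y < r x"
  using slope by simp

lemma residual_le: "l \<in> {1..n} \<Longrightarrow> \<bar>T l - r (t l)\<bar> \<le> E"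
  using max_norm_le_iff[OF n_ge(2), of "\<lambda>l. T l - r (t l)" E] E_eq by simp

lemma E_pos: "0 < E"
  using inner[of j] at_j order by simp

lemma T_ij: "T j < T i"
  using at_i at_j E_pos r_decreasing[OF t_ij] by linarith

lemma T_le_M: "l \<in> {2..n} \<Longrightarrow> T l \<le> M" and \<mu>_le_T: "l \<in> {2..n} \<Longrightarrow> \<mu> \<le> T l"
  by (auto simp: M_def \<mu>_def)

lemma M_attained: obtains l where "l \<in> {2..n}" "T l = M"
proof -
  have "M \<in> T ` {2..n}" unfolding M_def using n_ge by (intro Max_in) auto
  then show ?thesis using that by auto
qed

lemma \<mu>_attained: obtains l where "l \<in> {2..n}" "T l = \<mu>"
proof -
  have "\<mu> \<in> T ` {2..n}" unfolding \<mu>_def using n_ge by (intro Min_in) auto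
  then show ?thesis using that by auto
qed

lemma line_error: "E \<le> max_norm n (\<lambda>l. T l - (c * t l + d))"
  using best E_eq unfolding best_line_def by simp

section \<open>Improving on lines and step functions\<close>

text \<open>
  The correction must be positive where the residual is \<open>E\<close> and negative where it is \<open>-E\<close>. A convex
  exponential through two points of the line, one between \<open>i\<close> and its successor and one between
  \<open>m\<close> and its predecessor, separates the two kinds of points, and it tends to the line as \<open>k \<rightarrow> 0\<close>.
\<close>

lemma exponential_beats_line:
  obtains a b k where "a * k \<noteq> 0" "err a b k < E"
proof -
  obtain u where u: "t i < u" "u < t (Suc i)"
    using dense[OF t_less[of i "Suc i"]] order by auto
  obtain w where w: "t (m - 1) < w" "w < t m"
    using dense[OF t_less[of "m - 1" m]] order by fastforce
  have before: "t l < u" if "1 \<le> l" "l \<le> i" for l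
    using t_less[of l i] that u order by (cases "l = i") auto
  have between: "u < t l \<and> t l < w" if "i < l" "l < m" for l
  proof -
    have "t (Suc i) \<le> t l" using t_less[of "Suc i" l] that order by (cases "l = Suc i") auto
    moreover have "t l \<le> t (m - 1)"
      using t_less[of l "m - 1"] that order by (cases "l = m - 1") (simp_all, linarith)
    ultimately show ?thesis using u w by linarith
  qed
  have after: "w < t l" if "m \<le> l" "l \<le> n" for l
    using t_less[of m l] that w order by (cases "l = m") auto
  have "u < w" using between[OF order(2,3)] by linarith
  define f where "f k x = r u + (r w - r u) * exp_chord k u w x" for k x
  define g where "g k l = f k (t l) - r (t l)" for k l
  have g_eq: "g k l = (r w - r u) * (exp_chord k u w (t l) - (t l - u) / (w - u))" for k l
    using \<open>u < w\<close> by (simp add: g_def f_def field_simps)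
  have neg: "r w - r u < 0" using r_decreasing[OF \<open>u < w\<close>] by simp
  have k_neg: "\<forall>\<^sub>F k in at_left 0. k < (0::real)"
    by (simp add: eventually_at_filter)
  have "\<forall>\<^sub>F k in at_left 0. \<forall>l\<in>{1..n}. \<bar>(T l - r (t l)) - g k l\<bar> < E"
  proof (rule eventually_perturbed_residual_less[OF _ E_pos])
    fix l assume l: "l \<in> {1..n}"
    show "\<bar>T l - r (t l)\<bar> \<le> E" using residual_le[OF l] .
    have "((\<lambda>k. exp_chord k u w (t l) - (t l - u) / (w - u)) \<longlongrightarrow> 0) (at_left 0)"
      using exp_chord_tendsto_line[OF \<open>u < w\<close>, of "t l"]
      by (intro LIM_zero) (auto intro: tendsto_within_subset)
    then show "((\<lambda>k. g k l) \<longlongrightarrow> 0) (at_left 0)"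
      unfolding g_eq by (rule tendsto_mult_right_zero)
    show "\<forall>\<^sub>F k in at_left 0. 0 < g k l" if "T l - r (t l) = E"
    proof -
      have "\<not> (i < l \<and> l < m)" using inner[of l] that by auto
      then have "t l < u \<or> w < t l" using before[of l] after[of l] l by force
      then have chord: "exp_chord k u w (t l) < (t l - u) / (w - u)" if "k < 0" for k
        using exp_chord_vs_line(2)[OF that \<open>u < w\<close>] by blast
      show ?thesis using k_neg
        by eventually_elim (unfold g_eq, rule mult_neg_neg[OF neg], use chord in simp)
    qed
    show "\<forall>\<^sub>F k in at_left 0. g k l < 0" if "T l - r (t l) = - E"
    proof -
      have "\<not> (l < i \<or> m < l)" using outer[OF l] that by auto
      moreover have "l \<noteq> i" "l \<noteq> m" using that at_i at_m E_pos by auto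
      ultimately have "u < t l" "t l < w" using between[of l] by auto
      then have chord: "(t l - u) / (w - u) < exp_chord k u w (t l)" if "k < 0" for k
        using exp_chord_vs_line(1)[OF that \<open>u < w\<close>] by blast
      show ?thesis using k_neg
        by eventually_elim (unfold g_eq, rule mult_neg_pos[OF neg], use chord in simp)
    qed
  qed simp
  with k_neg have "\<forall>\<^sub>F k in at_left 0. k < 0 \<and> (\<forall>l\<in>{1..n}. \<bar>f k (t l) - T l\<bar> < E)"
    by eventually_elim (auto simp: g_def abs_minus_commute)
  then obtain k where k: "k < 0" "\<forall>l\<in>{1..n}. \<bar>f k (t l) - T l\<bar> < E"
    using eventually_happens[of _ "at_left (0::real)"] by auto
  obtain a b where "a * k \<noteq> 0" "\<And>x. f k x = a * exp (k * x) + b"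
    using exp_chord_is_exponential[of k "r w - r u" u w "r u"] k(1) neg \<open>u < w\<close>
    unfolding f_def by (metis order_less_irrefl)
  with k(2) show ?thesis
    using that[of a k b] max_norm_less_iff[OF n_ge(2)] by simp
qed

text \<open>
  An error below \<open>E\<close> forces the exponential above, below and above the line at \<open>t i\<close>, \<open>t j\<close>, \<open>t m\<close>.
  The fall from \<open>t i\<close> to \<open>t j\<close> gives that \<open>a\<close> and \<open>k\<close> have opposite signs; the convexity of the
  pattern gives \<open>0 < a\<close>.
\<close>

lemma decreasing_if_below_E:
  assumes "err a b k < E"
  shows "k < 0"
proof -
  have bound: "\<bar>a * exp (k * t l) + b - T l\<bar> < E" if "l \<in> {1..n}" for l
    using assms that unfolding max_norm_less_iff[OF n_ge(2)] by blast
  have i: "r (t i) < a * exp (k * t i) + b" using bound[of i] at_i order by auto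
  have j: "a * exp (k * t j) + b < r (t j)" using bound[of j] at_j order by auto
  have m: "r (t m) < a * exp (k * t m) + b" using bound[of m] at_m order by auto
  have decreasing: "a * exp (k * t j) < a * exp (k * t i)"
    using i j r_decreasing[OF t_ij] by linarith
  then have "k \<noteq> 0" by auto
  have "0 < a"
  proof (rule ccontr)
    assume "\<not> 0 < a"
    have "(t m - t i) * exp (k * t j)
        \<le> (t m - t j) * exp (k * t i) + (t j - t i) * exp (k * t m)"
      using exp_scaled_strictly_convex[OF \<open>k \<noteq> 0\<close> t_ij t_jm] by simp
    then have "a * ((t m - t j) * exp (k * t i) + (t j - t i) * exp (k * t m))
        \<le> a * ((t m - t i) * exp (k * t j))"
      using \<open>\<not> 0 < a\<close> by (intro mult_left_mono_neg) auto
    moreover have "(t m - t j) * r (t i) < (t m - t j) * (a * exp (k * t i) + b)"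
      using i t_jm by (intro mult_strict_left_mono) auto
    moreover have "(t j - t i) * r (t m) < (t j - t i) * (a * exp (k * t m) + b)"
      using m t_ij by (intro mult_strict_left_mono) auto
    moreover have "(t m - t i) * (a * exp (k * t j) + b) < (t m - t i) * r (t j)"
      using j t_ij t_jm by (intro mult_strict_left_mono) auto
    ultimately show False by (simp add: algebra_simps)
  qed
  with decreasing have "k * t j < k * t i" by simp
  with t_ij show "k < 0"
    by (simp add: mult_less_cancel_left)
qed

text \<open>
  The competitor is the step function with values \<open>T 1\<close> at the first point and \<open>mid = (M + \<mu>) / 2\<close>
  afterwards. Its residual is extremal exactly at the occurrences of \<open>M\<close> and \<open>\<mu>\<close> after the first
  point, and the failure of \<open>spade\<close> puts the former before the latter, where a decreasing correction
  has the required signs.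
\<close>

lemma exponential_beats_steps:
  assumes "\<not> spade n T" and "(M - \<mu>) / 2 < E"
  obtains a b k where "a * k \<noteq> 0" "err a b k < (M - \<mu>) / 2"
proof -
  define \<delta> where "\<delta> = (M - \<mu>) / 2"
  define mid where "mid = (M + \<mu>) / 2"
  have mid: "mid + \<delta> = M" "mid - \<delta> = \<mu>" by (auto simp: mid_def \<delta>_def field_simps)
  have "\<delta> < E" using assms by (simp add: \<delta>_def)
  have "\<mu> \<le> M" using T_le_M[of 2] \<mu>_le_T[of 2] n_ge by auto
  \<comment> \<open>Otherwise \<open>T i - T j > 2 * E\<close> would be a difference of two values after the first point, hence at most \<open>M - \<mu>\<close>.\<close>
  have "i = 1"
  proof (rule ccontr)
    assume "i \<noteq> 1"
    then have "T i \<le> M" "\<mu> \<le> T j" using order by (auto intro!: T_le_M \<mu>_le_T)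
    moreover have "2 * E < T i - T j" using at_i at_j r_decreasing[OF t_ij] by linarith
    ultimately show False using \<open>\<delta> < E\<close> mid by linarith
  qed
  have T1_max: "T l \<le> T 1" if "l \<in> {1..n}" for l
  proof (cases "l = 1")
    case False
    then have "t 1 < t l" using that by (intro t_less) auto
    then have "r (t l) < r (t 1)" by (rule r_decreasing)
    then show ?thesis using residual_le[OF that] at_i \<open>i = 1\<close> by (simp add: abs_le_iff)
  qed simp
  have "mid < T 1"
  proof -
    have "\<mu> \<le> T j" using order by (intro \<mu>_le_T) auto
    then have "mid < r (t j)" using mid \<open>\<delta> < E\<close> at_j by linarith
    then show ?thesis using r_decreasing[OF t_ij] at_i E_pos \<open>i = 1\<close> by simp
  qed
  have "Max (T ` {1..n}) = T 1"
    using T1_max n_ge by (intro Max_eqI) auto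
  moreover have "Min (T ` {1..n}) = \<mu>"
  proof (rule Min_eqI)
    obtain l where "l \<in> {2..n}" "T l = \<mu>" by (rule \<mu>_attained)
    then show "\<mu> \<in> T ` {1..n}" by (auto intro!: image_eqI[of _ _ l])
    fix y assume "y \<in> T ` {1..n}"
    then obtain l where l: "l \<in> {1..n}" "y = T l" by auto
    have "\<mu> \<le> T 1" using \<open>mid < T 1\<close> mid \<open>\<mu> \<le> M\<close> by linarith
    then show "\<mu> \<le> y" using \<mu>_le_T[of l] l by (cases "l = 1") auto
  qed simp
  ultimately have M_before_\<mu>: "l \<le> z" if "l \<in> {2..n}" "z \<in> {2..n}" "T l = M" "T z = \<mu>" for l z
    using assms(1) that unfolding spade_def M_def by (force simp: not_less)
  have "0 < \<delta>"
  proof (rule ccontr)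
    assume "\<not> 0 < \<delta>"
    then have "M = \<mu>" using \<open>\<mu> \<le> M\<close> mid by linarith
    then have "T 2 = \<mu>" "T 3 = M"
      using T_le_M[of 2] T_le_M[of 3] \<mu>_le_T[of 2] \<mu>_le_T[of 3] n_ge by auto
    then show False using M_before_\<mu>[of 3 2] n_ge by auto
  qed
  \<comment> \<open>The last occurrence of \<open>M\<close>; every occurrence of \<open>\<mu>\<close> lies beyond it.\<close>
  define p where "p = Max {l \<in> {2..n}. T l = M}"
  have "p \<in> {l \<in> {2..n}. T l = M}"
    unfolding p_def using M_attained by (intro Max_in) auto
  then have p: "2 \<le> p" "p \<le> n" "T p = M" by auto
  have p_last: "l \<le> p" if "l \<in> {2..n}" "T l = M" for l
    unfolding p_def using that by (intro Max_ge) auto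
  have p_less: "p < z" if "z \<in> {2..n}" "T z = \<mu>" for z
    using M_before_\<mu>[of p z] that p \<open>0 < \<delta>\<close> mid by (cases "p = z") auto
  obtain z where "z \<in> {2..n}" "T z = \<mu>" by (rule \<mu>_attained)
  with p_less have "p < n" by fastforce
  obtain s where s: "t p < s" "s < t (Suc p)"
    using dense[OF t_less[of p "Suc p"]] p \<open>p < n\<close> by auto
  have "t 1 < s" using t_less[of 1 p] p s by auto
  define A where "A = T 1 - mid"
  have "0 < A" using \<open>mid < T 1\<close> by (simp add: A_def)
  define step :: "nat \<Rightarrow> real" where "step l = (if l = 1 then T 1 else mid)" for l
  \<comment> \<open>Takes the value \<open>mid\<close> at \<open>s\<close>, and nearly \<open>T 1\<close> at \<open>t 1\<close> when the rate is steep.\<close>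
  define f where "f k x = mid + A * (exp (k * (x - t 1)) - exp (k * (s - t 1)))" for k x
  have k_neg: "\<forall>\<^sub>F k in at_bot. k < (0::real)"
    by (rule eventually_gt_at_bot)
  have "\<forall>\<^sub>F k in at_bot. \<forall>l\<in>{1..n}. \<bar>(T l - step l) - (f k (t l) - step l)\<bar> < \<delta>"
  proof (rule eventually_perturbed_residual_less[OF _ \<open>0 < \<delta>\<close>])
    fix l assume l: "l \<in> {1..n}"
    show "\<bar>T l - step l\<bar> \<le> \<delta>"
      using T_le_M[of l] \<mu>_le_T[of l] mid l \<open>0 < \<delta>\<close> by (auto simp: step_def abs_le_iff)
    have exp_s: "((\<lambda>k. exp (k * (s - t 1))) \<longlongrightarrow> 0) at_bot"
      using \<open>t 1 < s\<close> by (intro exp_tendsto_0_at_bot) simp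
    show "((\<lambda>k. f k (t l) - step l) \<longlongrightarrow> 0) at_bot"
    proof (cases "l = 1")
      case True
      have "((\<lambda>k. - A * exp (k * (s - t 1))) \<longlongrightarrow> 0) at_bot"
        by (rule tendsto_mult_right_zero[OF exp_s])
      then show ?thesis
        using True by (simp add: f_def step_def A_def algebra_simps)
    next
      case False
      then have "t 1 < t l" using l by (intro t_less) auto
      then have "((\<lambda>k. exp (k * (t l - t 1)) - exp (k * (s - t 1))) \<longlongrightarrow> 0 - 0) at_bot"
        by (intro tendsto_diff exp_s exp_tendsto_0_at_bot) simp
      then show ?thesis
        using False by (simp add: f_def step_def tendsto_mult_right_zero)
    qed
    show "\<forall>\<^sub>F k in at_bot. 0 < f k (t l) - step l" if "T l - step l = \<delta>"
    proof -
      have "l \<noteq> 1" using that \<open>0 < \<delta>\<close> by (auto simp: step_def)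
      then have "l \<le> p" using that mid l by (intro p_last) (auto simp: step_def)
      then have "t l < s" using t_less[of l p] l p s by (cases "l = p") auto
      show ?thesis using k_neg
        by eventually_elim
          (use \<open>l \<noteq> 1\<close> \<open>0 < A\<close> \<open>t l < s\<close> in \<open>simp add: f_def step_def\<close>)
    qed
    show "\<forall>\<^sub>F k in at_bot. f k (t l) - step l < 0" if "T l - step l = - \<delta>"
    proof -
      have "l \<noteq> 1" using that \<open>0 < \<delta>\<close> by (auto simp: step_def)
      then have "p < l" using that mid l by (intro p_less) (auto simp: step_def)
      then have "s < t l" using t_less[of "Suc p" l] l p s by (cases "l = Suc p") auto
      show ?thesis using k_neg
        by eventually_elim
          (use \<open>l \<noteq> 1\<close> \<open>0 < A\<close> \<open>s < t l\<close> in \<open>simp add: f_def step_def mult_pos_neg\<close>)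
    qed
  qed simp
  with k_neg have "\<forall>\<^sub>F k in at_bot. k < 0 \<and> (\<forall>l\<in>{1..n}. \<bar>f k (t l) - T l\<bar> < \<delta>)"
    by eventually_elim (auto simp: abs_minus_commute)
  then obtain k where k: "k < 0" "\<forall>l\<in>{1..n}. \<bar>f k (t l) - T l\<bar> < \<delta>"
    using eventually_happens[of _ "at_bot :: real filter"] by auto
  define b where "b = mid - A * exp (k * (s - t 1))"
  have "f k x = A * exp (- k * t 1) * exp (k * x) + b" for x
  proof -
    have "exp (k * (x - t 1)) = exp (- k * t 1) * exp (k * x)"
      by (simp add: algebra_simps flip: exp_add)
    then show ?thesis unfolding f_def b_def by (simp only:) (simp add: algebra_simps)
  qed
  with k(2) have "err (A * exp (- k * t 1)) b k < \<delta>"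
    by (simp only: max_norm_less_iff[OF n_ge(2)])
  moreover have "A * exp (- k * t 1) * k \<noteq> 0" using k(1) \<open>0 < A\<close> by simp
  ultimately show ?thesis using that unfolding \<delta>_def by blast
qed

section \<open>Existence of a best exponential\<close>

text \<open>
  Every exponential with error at most \<open>e = err a0 b0 k0\<close> has its parameters in a compact box. The
  normalised coefficients \<open>p\<close>, \<open>q\<close> are bounded because they are read off from the values at the
  two ends. The rate is negative; it cannot be close to \<open>0\<close>, where the exponential would be close
  to a line of error at least \<open>E\<close>; nor can it be very negative, where the values at the
  points \<open>x\<close> and \<open>z\<close> at which \<open>T\<close> is \<open>M\<close> and \<open>\<mu>\<close> would nearly coincide. On the box the error is
  continuous and attains its minimum.
\<close>

lemma best_exponential_exists:
  assumes e0: "err a0 b0 k0 < E" "err a0 b0 k0 < (M - \<mu>) / 2"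
  obtains a b k where "a * k \<noteq> 0"
    "\<And>a' b' k'. err a b k \<le> err a' b' k'"
proof -
  define e where "e = err a0 b0 k0"
  define Q where "Q = \<bar>T n - T 1\<bar> + 2 * e"
  define \<phi> where "\<phi> k l = exp_chord k (t 1) (t n) (t l)" for k l
  define lin where "lin l = (t l - t 1) / (t n - t 1)" for l
  define F where "F = (\<lambda>(p, q, k). max_norm n (\<lambda>l. p + q * \<phi> k l - T l))"
  have "e < E" "e < (M - \<mu>) / 2" using e0 by (auto simp: e_def)
  have t1n: "t 1 < t n" using n_ge by (intro t_less) auto
  obtain x where x: "x \<in> {2..n}" "T x = M" by (rule M_attained)
  obtain z where z: "z \<in> {2..n}" "T z = \<mu>" by (rule \<mu>_attained)

  have "\<forall>\<^sub>F k in at_left 0. \<forall>l\<in>{1..n}. \<bar>Q * (\<phi> k l - lin l)\<bar> < E - e"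
  proof (rule eventually_ball_finite, simp, rule ballI)
    fix l
    have "((\<lambda>k. \<phi> k l - lin l) \<longlongrightarrow> 0) (at_left 0)"
      using exp_chord_tendsto_line[OF t1n, of "t l"]
      unfolding \<phi>_def lin_def by (intro LIM_zero) (auto intro: tendsto_within_subset)
    then have "((\<lambda>k. Q * (\<phi> k l - lin l)) \<longlongrightarrow> 0) (at_left 0)"
      by (rule tendsto_mult_right_zero)
    from tendstoD[OF this, of "E - e"] show "\<forall>\<^sub>F k in at_left 0. \<bar>Q * (\<phi> k l - lin l)\<bar> < E - e"
      using \<open>e < E\<close> by simp
  qed
  then obtain \<kappa> where \<kappa>: "\<kappa> < 0"
    "\<And>k l. \<kappa> < k \<Longrightarrow> k < 0 \<Longrightarrow> l \<in> {1..n} \<Longrightarrow> \<bar>Q * (\<phi> k l - lin l)\<bar> < E - e"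
    unfolding eventually_at_left_field by blast

  have "((\<lambda>k. Q * (\<phi> k x - \<phi> k z)) \<longlongrightarrow> Q * (1 - 1)) at_bot"
    unfolding \<phi>_def using x z t1n t_less
    by (intro tendsto_mult tendsto_diff tendsto_const exp_chord_tendsto_1_at_bot) auto
  from tendstoD[OF this, of "M - \<mu> - 2 * e"] \<open>e < (M - \<mu>) / 2\<close>
  have "\<forall>\<^sub>F k in at_bot. \<bar>Q * (\<phi> k x - \<phi> k z)\<bar> < M - \<mu> - 2 * e"
    by simp
  then obtain K where K: "\<And>k. k \<le> K \<Longrightarrow> \<bar>Q * (\<phi> k x - \<phi> k z)\<bar> < M - \<mu> - 2 * e"
    unfolding eventually_at_bot_linorder by blast

  define S where "S = {T 1 - e..T 1 + e} \<times> {- Q..Q} \<times> {K..\<kappa>}"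
  have param: "\<exists>s\<in>S. F s = err a b k" if "err a b k \<le> e" for a b k
  proof -
    define p where "p = a * exp (k * t 1) + b"
    define q where "q = a * exp (k * t n) - a * exp (k * t 1)"
    have "k < 0" using decreasing_if_below_E[of a k b] that \<open>e < E\<close> by linarith
    then have f: "a * exp (k * t l) + b = p + q * \<phi> k l" for l
      unfolding p_def q_def \<phi>_def using t1n by (intro exponential_eq_exp_chord) auto
    have bound: "\<bar>p + q * \<phi> k l - T l\<bar> \<le> e" if "l \<in> {1..n}" for l
      using \<open>err a b k \<le> e\<close> that unfolding f max_norm_le_iff[OF n_ge(2)] by blast
    have "\<bar>p - T 1\<bar> \<le> e" "\<bar>p + q - T n\<bar> \<le> e"
      using bound[of 1] bound[of n] n_ge t1n \<open>k < 0\<close> by (auto simp: \<phi>_def exp_chord_def)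
    then have p: "p \<in> {T 1 - e..T 1 + e}" and q: "\<bar>q\<bar> \<le> Q"
      by (auto simp: Q_def abs_le_iff)
    have scale: "\<bar>q * y\<bar> \<le> \<bar>Q * y\<bar>" for y
      using q by (simp add: abs_mult mult_right_mono)
    have "k \<le> \<kappa>"
    proof (rule ccontr)
      assume "\<not> k \<le> \<kappa>"
      define c where "c = q / (t n - t 1)"
      have "\<bar>T l - (c * t l + (p - c * t 1))\<bar> < E" if "l \<in> {1..n}" for l
      proof -
        have "c * t l + (p - c * t 1) = p + q * lin l"
          by (simp add: c_def lin_def right_diff_distrib diff_divide_distrib)
        moreover have "\<bar>q * (\<phi> k l - lin l)\<bar> < E - e"
          using scale[of "\<phi> k l - lin l"] \<kappa>(2)[of k l] \<open>\<not> k \<le> \<kappa>\<close> \<open>k < 0\<close> that by linarith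
        then have "\<bar>q * \<phi> k l - q * lin l\<bar> < E - e" by (simp add: algebra_simps)
        ultimately show ?thesis using bound[OF that] by linarith
      qed
      then have "max_norm n (\<lambda>l. T l - (c * t l + (p - c * t 1))) < E"
        unfolding max_norm_less_iff[OF n_ge(2)] by blast
      with line_error[of c "p - c * t 1"] show False by linarith
    qed
    moreover have "K \<le> k"
    proof (rule ccontr)
      assume "\<not> K \<le> k"
      then have "\<bar>q * (\<phi> k x - \<phi> k z)\<bar> < M - \<mu> - 2 * e"
        using scale[of "\<phi> k x - \<phi> k z"] K[of k] by linarith
      then have "\<bar>q * \<phi> k x - q * \<phi> k z\<bar> < M - \<mu> - 2 * e" by (simp add: algebra_simps)
      with bound[of x] bound[of z] x z show False by auto
    qed
    ultimately have "(p, q, k) \<in> S" using p q by (simp add: S_def abs_le_iff)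
    moreover have "F (p, q, k) = err a b k" by (simp add: F_def f)
    ultimately show ?thesis by blast
  qed
  obtain s0 where s0: "s0 \<in> S" "F s0 = e" using param[of a0 k0 b0] by (auto simp: e_def)
  have "compact S" unfolding S_def by (intro compact_Times) auto
  moreover have "continuous_on S F"
  proof -
    have "exp (k * (t n - t 1)) - 1 \<noteq> 0" if "k \<le> \<kappa>" for k
      using that \<kappa>(1) t1n by auto
    then show ?thesis
      unfolding F_def max_norm_def case_prod_beta \<phi>_def exp_chord_def using n_ge
      by (intro continuous_on_Max_image) (auto intro!: continuous_intros simp: S_def)
  qed
  ultimately obtain s where s: "s \<in> S" "\<And>y. y \<in> S \<Longrightarrow> F s \<le> F y"
    using continuous_attains_inf[of S F] s0 by blast
  obtain p q k where pqk: "s = (p, q, k)" by (cases s)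
  have "F s \<le> e" using s(2)[OF s0(1)] s0(2) by linarith
  \<comment> \<open>The box contains the constants \<open>q = 0\<close>, which are not exponentials; but they are lines.\<close>
  have "q \<noteq> 0"
  proof
    assume "q = 0"
    then have "F s = max_norm n (\<lambda>l. T l - (0 * t l + p))"
      by (simp add: F_def pqk max_norm_def abs_minus_commute)
    with line_error[of 0 p] \<open>F s \<le> e\<close> \<open>e < E\<close> show False by linarith
  qed
  moreover have "k \<noteq> 0" using s(1) \<kappa>(1) by (auto simp: S_def pqk)
  ultimately obtain a b where ab: "a * k \<noteq> 0"
    "\<And>x. p + q * exp_chord k (t 1) (t n) x = a * exp (k * x) + b"
    using exp_chord_is_exponential t1n by blast
  then have F_err: "F s = err a b k" by (simp add: F_def pqk \<phi>_def)
  have "err a b k \<le> err a' b' k'" for a' b' k'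
  proof (cases "err a' b' k' \<le> e")
    case True
    obtain y where "y \<in> S" "F y = err a' b' k'" using param[OF True] by blast
    with s(2)[of y] F_err show ?thesis by linarith
  next
    case False
    then show ?thesis using \<open>F s \<le> e\<close> F_err by linarith
  qed
  with ab(1) show ?thesis using that by blast
qed

text \<open>
  An exponential of error at most \<open>\<delta> = (M - \<mu>) / 2\<close> would be on or above \<open>mid\<close> at \<open>t 1\<close>, on or
  below it at \<open>t z\<close>, and on or above it at \<open>t x\<close>, which a strictly monotone function cannot be. So
  its error exceeds \<open>\<delta>\<close>, and exponentials steep enough approach the step function with error \<open>\<delta>\<close>.
\<close>

lemma no_best_exponential_if_spade:
  assumes "spade n T" "a * k \<noteq> 0"
  obtains a' b' k' where "a' * k' \<noteq> 0" "err a' b' k' < err a b k"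
proof -
  define \<delta> where "\<delta> = (M - \<mu>) / 2"
  define mid where "mid = (M + \<mu>) / 2"
  have mid: "mid + \<delta> = M" "mid - \<delta> = \<mu>" by (auto simp: mid_def \<delta>_def field_simps)
  obtain z x where zx: "z \<in> {1..n}" "x \<in> {2..n}" "z < x" "T z = Min (T ` {1..n})" "T x = M"
    and "T 1 = Max (T ` {1..n})"
    using assms(1) unfolding spade_def M_def by auto
  then have T1_max: "T l \<le> T 1" and z_min: "T z \<le> T l" if "l \<in> {1..n}" for l
    using that by auto
  have ij: "i \<in> {1..n}" "j \<in> {1..n}" using order by auto
  have T1_z: "T z < T 1" using T1_max[OF ij(1)] z_min[OF ij(2)] T_ij by linarith
  then have "2 \<le> z" using zx by (cases "z = 1") auto
  obtain y where y: "y \<in> {2..n}" "T y = \<mu>" by (rule \<mu>_attained)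
  have "T z = \<mu>"
    using z_min[of y] y \<mu>_le_T[of z] zx \<open>2 \<le> z\<close> by (intro antisym) auto
  have "M \<le> T 1" using T1_max[of x] zx by auto
  have "\<mu> \<le> M" using T_le_M[of z] \<open>T z = \<mu>\<close> \<open>2 \<le> z\<close> zx by auto
  have order_t: "t 1 < t z" "t z < t x"
    using t_less[of 1 z] t_less[of z x] \<open>2 \<le> z\<close> zx by auto
  have "\<delta> < err a b k"
  proof (rule ccontr)
    assume "\<not> \<delta> < err a b k"
    then have bound: "\<bar>a * exp (k * t l) + b - T l\<bar> \<le> \<delta>" if "l \<in> {1..n}" for l
      using that unfolding not_less max_norm_le_iff[OF n_ge(2)] by blast
    have 1: "mid \<le> a * exp (k * t 1) + b"
      using bound[of 1] \<open>M \<le> T 1\<close> mid n_ge by auto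
    have 2: "a * exp (k * t z) + b \<le> mid"
      using bound[of z] zx \<open>T z = \<mu>\<close> mid by auto
    have 3: "mid \<le> a * exp (k * t x) + b"
      using bound[of x] zx mid by auto
    consider "0 < a" "0 < k" | "0 < a" "k < 0" | "a < 0" "0 < k" | "a < 0" "k < 0"
      using assms(2) by fastforce
    then show False
    proof cases
      case 1
      then have "a * exp (k * t 1) < a * exp (k * t z)" using order_t by simp
      with \<open>mid \<le> a * exp (k * t 1) + b\<close> 2 show False by linarith
    next
      case 2
      then have "a * exp (k * t x) < a * exp (k * t z)" using order_t by simp
      with \<open>a * exp (k * t z) + b \<le> mid\<close> 3 show False by linarith
    next
      case 3
      then have "a * exp (k * t x) < a * exp (k * t z)" using order_t by simp
      with \<open>mid \<le> a * exp (k * t x) + b\<close> 2 show False by linarith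
    next
      case 4
      then have "a * exp (k * t 1) < a * exp (k * t z)" using order_t by simp
      with 1 2 show False by linarith
    qed
  qed
  define A where "A = T 1 - mid"
  have "0 < A"
    using T1_z \<open>T z = \<mu>\<close> \<open>M \<le> T 1\<close> mid by (simp add: A_def)
  have "t 1 < t 2" using n_ge by (intro t_less) auto
  then have "((\<lambda>k. A * exp (k * (t 2 - t 1))) \<longlongrightarrow> 0) at_bot"
    by (intro tendsto_mult_right_zero exp_tendsto_0_at_bot) simp
  from tendstoD[OF this, of "err a b k - \<delta>"]
  have "\<forall>\<^sub>F k' in at_bot. A * exp (k' * (t 2 - t 1)) < err a b k - \<delta>"
    using \<open>\<delta> < err a b k\<close> \<open>0 < A\<close> by simp
  with eventually_gt_at_bot[of "0::real"]
  have "\<forall>\<^sub>F k' in at_bot. k' < 0 \<and> A * exp (k' * (t 2 - t 1)) < err a b k - \<delta>"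
    by eventually_elim simp
  then obtain k' where k': "k' < 0" "A * exp (k' * (t 2 - t 1)) < err a b k - \<delta>"
    using eventually_happens[of _ "at_bot :: real filter"] by auto
  \<comment> \<open>The exponential \<open>mid + A * exp (k' * (x - t 1))\<close> interpolates \<open>T 1\<close> at \<open>t 1\<close>.\<close>
  define a' where "a' = A * exp (- k' * t 1)"
  have a': "a' * exp (k' * t l) = A * exp (k' * (t l - t 1))" for l
    by (simp add: a'_def algebra_simps flip: exp_add)
  have "\<bar>a' * exp (k' * t l) + mid - T l\<bar> < err a b k" if "l \<in> {1..n}" for l
  proof (cases "l = 1")
    case True
    then show ?thesis
      using \<open>\<delta> < err a b k\<close> \<open>\<mu> \<le> M\<close> mid unfolding a' by (simp add: A_def)
  next
    case False
    then have "t 2 \<le> t l" using t_less[of 2 l] that by (cases "l = 2") auto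
    then have "A * exp (k' * (t l - t 1)) \<le> A * exp (k' * (t 2 - t 1))"
      using k'(1) \<open>0 < A\<close> by simp
    moreover have "0 < A * exp (k' * (t l - t 1))" using \<open>0 < A\<close> by simp
    moreover have "\<bar>mid - T l\<bar> \<le> \<delta>"
      using T_le_M[of l] \<mu>_le_T[of l] mid that False by (auto simp: abs_le_iff)
    ultimately show ?thesis unfolding a' using k'(2) by linarith
  qed
  then have "err a' mid k' < err a b k" unfolding max_norm_less_iff[OF n_ge(2)] by blast
  moreover have "a' * k' \<noteq> 0" using \<open>0 < A\<close> k'(1) by (simp add: a'_def)
  ultimately show ?thesis using that by blast
qed

lemma best_exponential_iff_not_spade:
  "(\<exists>a b k. a * k \<noteq> 0 \<and> (\<forall>a' b' k'. a' * k' \<noteq> 0 \<longrightarrow> err a b k \<le> err a' b' k'))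
    \<longleftrightarrow> \<not> spade n T"
proof
  assume "\<exists>a b k. a * k \<noteq> 0 \<and> (\<forall>a' b' k'. a' * k' \<noteq> 0 \<longrightarrow> err a b k \<le> err a' b' k')"
  then obtain a b k where abk: "a * k \<noteq> 0"
    and best: "\<And>a' b' k'. a' * k' \<noteq> 0 \<Longrightarrow> err a b k \<le> err a' b' k'"
    by blast
  show "\<not> spade n T"
  proof
    assume "spade n T"
    then obtain a' b' k' where "a' * k' \<noteq> 0" "err a' b' k' < err a b k"
      by (rule no_best_exponential_if_spade[OF _ abk])
    with best show False by (meson not_less)
  qed
next
  assume spade: "\<not> spade n T"
  obtain a b k where "err a b k < E" "err a b k < (M - \<mu>) / 2"
  proof (cases "(M - \<mu>) / 2 < E")
    case True
    obtain a b k where "err a b k < (M - \<mu>) / 2"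
      using exponential_beats_steps[OF spade True] by blast
    with True show ?thesis by (intro that[of a k b]) linarith+
  next
    case False
    obtain a b k where "err a b k < E" using exponential_beats_line by blast
    with False show ?thesis by (intro that[of a k b]) linarith+
  qed
  then obtain a b k where "a * k \<noteq> 0" "\<And>a' b' k'. err a b k \<le> err a' b' k'"
    by (rule best_exponential_exists) blast
  then show "\<exists>a b k. a * k \<noteq> 0 \<and> (\<forall>a' b' k'. a' * k' \<noteq> 0 \<longrightarrow> err a b k \<le> err a' b' k')"
    by blast
qed

end

theorem theorem1:
  fixes n :: nat and t T :: "nat \<Rightarrow> real"
  assumes "admissible n t T"
  shows "(\<exists>a b k. a * k \<noteq> 0 \<and>
            (\<forall>a' b' k'. a' * k' \<noteq> 0 \<longrightarrow>
               max_norm n (\<lambda>i. a * exp (k * t i) + b - T i)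
                 \<le> max_norm n (\<lambda>i. a' * exp (k' * t i) + b' - T i)))
         \<longleftrightarrow> \<not> spade n T"
proof -
  define E where "E \<alpha> \<beta> = max_norm n (\<lambda>l. T l - (\<alpha> * t l + \<beta>))" for \<alpha> \<beta>
  obtain \<alpha> \<beta> where "best_line n t T \<alpha> \<beta>" "\<alpha> < 0" and pattern:
    "\<exists>i j m. 1 \<le> i \<and> i < j \<and> j < m \<and> m \<le> n \<and>
       T i - (\<alpha> * t i + \<beta>) = E \<alpha> \<beta> \<and> (\<alpha> * t j + \<beta>) - T j = E \<alpha> \<beta> \<and> T m - (\<alpha> * t m + \<beta>) = E \<alpha> \<beta> \<and>
       (\<forall>l\<in>{1..n}. l < i \<or> m < l \<longrightarrow>
          - E \<alpha> \<beta> \<le> (\<alpha> * t l + \<beta>) - T l \<and> (\<alpha> * t l + \<beta>) - T l < E \<alpha> \<beta>) \<and>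
       (\<forall>l\<in>{1..n}. i < l \<and> l < m \<longrightarrow>
          - E \<alpha> \<beta> \<le> T l - (\<alpha> * t l + \<beta>) \<and> T l - (\<alpha> * t l + \<beta>) < E \<alpha> \<beta>)"
    using assms unfolding admissible_def Let_def E_def by blast
  moreover have "strict_mono_on {1..n} t"
    using assms by (simp add: admissible_def dataset_def)
  moreover obtain i j m where ijm: "1 \<le> i" "i < j" "j < m" "m \<le> n"
    "T i - (\<alpha> * t i + \<beta>) = E \<alpha> \<beta>" "(\<alpha> * t j + \<beta>) - T j = E \<alpha> \<beta>"
    "T m - (\<alpha> * t m + \<beta>) = E \<alpha> \<beta>"
    and outer: "\<forall>l\<in>{1..n}. l < i \<or> m < l \<longrightarrow> (\<alpha> * t l + \<beta>) - T l < E \<alpha> \<beta>"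
    and inner: "\<forall>l\<in>{1..n}. i < l \<and> l < m \<longrightarrow> T l - (\<alpha> * t l + \<beta>) < E \<alpha> \<beta>"
    using pattern by blast
  moreover have "T l - (\<alpha> * t l + \<beta>) < E \<alpha> \<beta>" if "i < l" "l < m" for l
    using inner that ijm by simp
  ultimately have "convex_residual n t T \<alpha> \<beta> (E \<alpha> \<beta>) i j m"
    by unfold_locales (auto simp: E_def)
  then show ?thesis
    by (rule convex_residual.best_exponential_iff_not_spade)
qed

end
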